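(* Let $n\geq 2$ and let $S_n$ be the Cayley graph on $\mathbb{Z}_{2n}\times\mathbb{Z}_4$ with connection set $$S=\{(0,1),(0,3),(2i+1,0),(2i+1,1),(2i+1,3)\mid 0\leq i\leq n-1\}.$$ Then $S_n$ is a connected CIS graph of order $8n$ and valency $3n+2$ with $\alpha(S_n)=2n$ and $\omega(S_n)=4$.
   Context: For a group $G$ (written additively here) and an inverse-closed subset $S\subseteq G$ not containing the identity, the Cayley graph on $G$ with connection set $S$ has vertex set $G$, with $g,h$ adjacent if and only if $h-g\in S$. A clique (respectively, stable set) is a set of pairwise adjacent (respectively, pairwise non-adjacent) vertices; "maximal" means maximal with respect to inclusion. $\omega(\Gamma)$ and $\alpha(\Gamma)$ denote the largest cardinality of a clique and of a stable set of $\Gamma$. A graph is CIS if every maximal stable set and every maximal clique have non-empty intersection. A graph has valency $k$ if every vertex has exactly $k$ neighbors; the order is the number of vertices. *)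

theory Defs
  imports "HOL-Algebra.Elementary_Groups" "Graph_Theory.Graph_Theory"
begin

(* Graphs are pair digraphs whose arc relation is irreflexive and symmetric (locale pair_graph):
   an edge {g, h} is the pair of arcs (g, h), (h, g). *)

definition cayley_graph :: "('a, 'b) monoid_scheme \<Rightarrow> 'a set \<Rightarrow> 'a pair_pre_digraph" where
  "cayley_graph G S =
     \<lparr>pverts = carrier G,
      parcs = {(g, h). g \<in> carrier G \<and> h \<in> carrier G \<and> h \<otimes>\<^bsub>G\<^esub> inv\<^bsub>G\<^esub> g \<in> S}\<rparr>"

lemma pair_graph_cayley_graph:
  fixes G (structure)
  assumes "group G" and fin: "finite (carrier G)" and sub: "S \<subseteq> carrier G"
    and S_inv: "\<And>s. s \<in> S \<Longrightarrow> inv s \<in> S" and no_one: "\<one> \<notin> S"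
  shows "pair_graph (cayley_graph G S)"
proof -
  interpret group G by fact
  have flip: "g \<otimes> inv h \<in> S" if "g \<in> carrier G" "h \<in> carrier G" "h \<otimes> inv g \<in> S" for g h
    using S_inv[OF that(3)] that(1,2) by (simp add: inv_mult_group)
  show ?thesis
  proof
    show "finite (parcs (cayley_graph G S))"
      by (rule finite_subset[of _ "carrier G \<times> carrier G"]) (auto simp: cayley_graph_def fin)
    show "fst e \<noteq> snd e" if "e \<in> parcs (cayley_graph G S)" for e
      using that no_one by (auto simp: cayley_graph_def)
    show "symmetric (with_proj (cayley_graph G S))"
      unfolding symmetric_def by (rule symI) (use flip in \<open>simp add: cayley_graph_def\<close>)
  qed (auto simp: cayley_graph_def fin)
qed

definition is_clique :: "'a pair_pre_digraph \<Rightarrow> 'a set \<Rightarrow> bool" where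
  "is_clique G C \<longleftrightarrow>
     C \<subseteq> pverts G \<and> (\<forall>u\<in>C. \<forall>v\<in>C. u \<noteq> v \<longrightarrow> (u, v) \<in> parcs G)"

definition is_stable :: "'a pair_pre_digraph \<Rightarrow> 'a set \<Rightarrow> bool" where
  "is_stable G T \<longleftrightarrow>
     T \<subseteq> pverts G \<and> (\<forall>u\<in>T. \<forall>v\<in>T. u \<noteq> v \<longrightarrow> (u, v) \<notin> parcs G)"

definition maximal_clique :: "'a pair_pre_digraph \<Rightarrow> 'a set \<Rightarrow> bool" where
  "maximal_clique G C \<longleftrightarrow> is_clique G C \<and> (\<forall>D. is_clique G D \<and> C \<subseteq> D \<longrightarrow> D = C)"

definition maximal_stable :: "'a pair_pre_digraph \<Rightarrow> 'a set \<Rightarrow> bool" where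
  "maximal_stable G T \<longleftrightarrow> is_stable G T \<and> (\<forall>U. is_stable G U \<and> T \<subseteq> U \<longrightarrow> U = T)"

definition clique_number :: "'a pair_pre_digraph \<Rightarrow> nat" where
  "clique_number G = Max (card ` {C. is_clique G C})"

definition stability_number :: "'a pair_pre_digraph \<Rightarrow> nat" where
  "stability_number G = Max (card ` {T. is_stable G T})"

definition CIS :: "'a pair_pre_digraph \<Rightarrow> bool" where
  "CIS G \<longleftrightarrow> (\<forall>T C. maximal_stable G T \<and> maximal_clique G C \<longrightarrow> T \<inter> C \<noteq> {})"

definition has_valency :: "'a pair_pre_digraph \<Rightarrow> nat \<Rightarrow> bool" where
  "has_valency G k \<longleftrightarrow> (\<forall>v\<in>pverts G. card {w. (v, w) \<in> parcs G} = k)"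

abbreviation Sn_group :: "nat \<Rightarrow> (int \<times> int) monoid" where
  "Sn_group n \<equiv> integer_mod_group (2 * n) \<times>\<times> integer_mod_group 4"

(* Residues are the representatives {0..<2n} and {0..<4}. *)
definition Sn_conn :: "nat \<Rightarrow> (int \<times> int) set" where
  "Sn_conn n =
     {(0, 1), (0, 3)} \<union>
     (\<Union>i\<in>{0..int n - 1}. {(2 * i + 1, 0), (2 * i + 1, 1), (2 * i + 1, 3)})"

definition Sn :: "nat \<Rightarrow> (int \<times> int) pair_pre_digraph" where
  "Sn n = cayley_graph (Sn_group n) (Sn_conn n)"

lemma pair_graph_Sn:
  assumes "n \<ge> 2"
  shows "pair_graph (Sn n)"
  unfolding Sn_def
proof (rule pair_graph_cayley_graph)
  have grp: "group (integer_mod_group k)" for k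
    by (rule group_integer_mod_group)
  show "group (Sn_group n)"
    by (intro DirProd_group grp)
  show "finite (carrier (Sn_group n))"
    using assms by (simp add: carrier_integer_mod_group)
  show sub: "Sn_conn n \<subseteq> carrier (Sn_group n)"
    using assms by (auto simp: Sn_conn_def carrier_integer_mod_group)
  show "\<one>\<^bsub>Sn_group n\<^esub> \<notin> Sn_conn n"
    by (auto simp: Sn_conn_def)
  show "inv\<^bsub>Sn_group n\<^esub> s \<in> Sn_conn n" if s: "s \<in> Sn_conn n" for s
  proof -
    obtain a b where ab: "s = (a, b)" by (cases s)
    have mem: "a \<in> carrier (integer_mod_group (2 * n))" "b \<in> carrier (integer_mod_group 4)"
      using s sub ab by auto
    have inv: "inv\<^bsub>Sn_group n\<^esub> s = ((- a) mod (2 * int n), (- b) mod 4)"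
      using mem by (simp add: ab inv_DirProd[OF grp grp])
    have neg: "(- (2 * i + 1)) mod (2 * int n) = 2 * (int n - 1 - i) + 1"
      if "0 \<le> i" "i \<le> int n - 1" for i
    proof -
      have "(- (2 * i + 1)) mod (2 * int n) = (- (2 * i + 1) + 2 * int n) mod (2 * int n)"
        by simp
      also have "\<dots> = - (2 * i + 1) + 2 * int n"
        using that by (intro mod_pos_pos_trivial) auto
      finally show ?thesis by simp
    qed
    consider "a = 0" "b \<in> {1, 3}"
      | i where "0 \<le> i" "i \<le> int n - 1" "a = 2 * i + 1" "b \<in> {0, 1, 3}"
      using s ab by (auto simp: Sn_conn_def)
    then show ?thesis
    proof cases
      case 1
      then show ?thesis unfolding inv by (auto simp: Sn_conn_def)
    next
      case 2
      have idx: "int n - 1 - i \<in> {0..int n - 1}" using 2 by simp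
      have "(- b) mod 4 = 0 \<or> (- b) mod 4 = 1 \<or> (- b) mod 4 = 3" using 2(4) by auto
      then show ?thesis
        unfolding inv 2(3) neg[OF 2(1,2)] Sn_conn_def by (intro UnI2 UN_I[OF idx]) simp
    qed
  qed
qed

end

theory Submission
  imports Defs
begin

text \<open>Two vertices in the same copy of Z_4 are adjacent iff they are consecutive, two vertices whose
  first coordinates have different parity are adjacent iff their second coordinates are not
  antipodal, and there are no other edges. Hence the maximal cliques are the sets
  {x, y} \<times> {c, c+1} with x even and y odd. A maximal stable set T containing vertices of both
  parities is (evens \<times> {a}) \<union> (odds \<times> {a+2}), and {c, c+1} contains a or a+2; if only one parity
  occurs in T, then T meets each Z_4 of that parity in an antipodal pair, hence meets {c, c+1}
  there. The bounds on the clique and stability numbers come from partitioning the vertices into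
  4 stable sets (parities of both coordinates) and into 2n cliques
  {2i, 2i+1} \<times> {2j, 2j+1}.\<close>

section \<open>Adjacency in coordinates and valency\<close>

text \<open>An odd residue below \<open>2 * n\<close> has the form \<open>2 * i + 1\<close> with
  \<open>i\<close> in the prescribed range, so the enumeration becomes a parity condition.\<close>

lemma Sn_conn_iff:
  assumes "0 \<le> a" "a < 2 * int n" "0 \<le> b" "b < 4"
  shows "(a, b) \<in> Sn_conn n \<longleftrightarrow> (a = 0 \<and> odd b) \<or> (odd a \<and> b \<noteq> 2)"
proof -
  have b: "b \<in> {0, 1, 2, 3}"
    using assms(3,4) by auto
  have a: "odd a \<longleftrightarrow> (\<exists>i\<in>{0..int n - 1}. a = 2 * i + 1)"
    using assms(1,2) by (auto elim!: oddE)
  show ?thesis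
    unfolding a using b by (auto simp: Sn_conn_def)
qed

lemma card_Sn_conn: "card (Sn_conn n) = 3 * n + 2"
proof -
  let ?O = "(\<lambda>i. 2 * i + 1) ` {0..int n - 1}"
  have eq: "Sn_conn n = {0} \<times> {1, 3} \<union> ?O \<times> {0, 1, 3}"
    by (auto simp: Sn_conn_def)
  have "card ?O = n"
    by (subst card_image) (auto simp: inj_on_def)
  moreover have "({0} \<times> {1, 3}) \<inter> (?O \<times> {0, 1, 3 :: int}) = {}"
    by auto presburger
  ultimately show ?thesis
    unfolding eq by (subst card_Un_disjoint) (auto simp: card_cartesian_product)
qed

text \<open>The neighbours of \<open>g\<close> form the right translate of \<open>S\<close> by
  \<open>g\<close>, and right multiplication is injective.\<close>

lemma has_valency_cayley_graph:
  fixes G (structure)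
  assumes "group G" and sub: "S \<subseteq> carrier G"
  shows "has_valency (cayley_graph G S) (card S)"
  unfolding has_valency_def
proof
  interpret group G by fact
  fix g assume "g \<in> pverts (cayley_graph G S)"
  then have g: "g \<in> carrier G"
    by (simp add: cayley_graph_def)
  have "{h. (g, h) \<in> parcs (cayley_graph G S)} = (\<lambda>s. s \<otimes> g) ` S"
  proof (intro equalityI subsetI)
    fix h assume "h \<in> {h. (g, h) \<in> parcs (cayley_graph G S)}"
    then have "h \<in> carrier G" "h \<otimes> inv g \<in> S"
      by (auto simp: cayley_graph_def)
    moreover from this g have "h = h \<otimes> inv g \<otimes> g"
      by (simp add: m_assoc)
    ultimately show "h \<in> (\<lambda>s. s \<otimes> g) ` S"
      by blast
  qed (use g sub in \<open>auto simp: cayley_graph_def m_assoc subset_iff\<close>)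
  moreover have "inj_on (\<lambda>s. s \<otimes> g) S"
    using g sub by (auto simp: inj_on_def subset_iff)
  ultimately show "card {h. (g, h) \<in> parcs (cayley_graph G S)} = card S"
    by (simp add: card_image)
qed

lemma pverts_Sn:
  assumes "n \<ge> 2"
  shows "pverts (Sn n) = {0..<2 * int n} \<times> {0..<4}"
  using assms by (simp add: Sn_def cayley_graph_def carrier_integer_mod_group)

text \<open>The moduli \<open>2 * n\<close> and 4 are even, so reduction keeps parities, and
  representatives in range that agree modulo \<open>2 * n\<close> are equal. Adjacency can thus be
  read off plain integer differences.\<close>

lemma arc_Sn_iff:
  assumes n: "n \<ge> 2" and u: "(x, a) \<in> pverts (Sn n)" and v: "(y, b) \<in> pverts (Sn n)"
  shows "((x, a), (y, b)) \<in> parcs (Sn n) \<longleftrightarrow>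
    (x = y \<and> odd (b - a)) \<or> (odd (y - x) \<and> (b - a) mod 4 \<noteq> 2)"
proof -
  have ranges: "0 \<le> x" "x < 2 * int n" "0 \<le> y" "y < 2 * int n"
    "0 \<le> a" "a < 4" "0 \<le> b" "b < 4"
    using u v by (auto simp: pverts_Sn[OF n])
  then have carr: "x \<in> carrier (integer_mod_group (2 * n))" "a \<in> carrier (integer_mod_group 4)"
    "y \<in> carrier (integer_mod_group (2 * n))" "b \<in> carrier (integer_mod_group 4)"
    using n by (simp_all add: carrier_integer_mod_group)
  have grp: "group (integer_mod_group k)" for k
    by (rule group_integer_mod_group)
  have "(y, b) \<otimes>\<^bsub>Sn_group n\<^esub> inv\<^bsub>Sn_group n\<^esub> (x, a) = ((y - x) mod (2 * int n), (b - a) mod 4)"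
    using carr by (simp add: inv_DirProd[OF grp grp] mod_simps)
  then have "((x, a), (y, b)) \<in> parcs (Sn n) \<longleftrightarrow>
      ((y - x) mod (2 * int n), (b - a) mod 4) \<in> Sn_conn n"
    using carr by (simp add: Sn_def cayley_graph_def)
  also have "\<dots> \<longleftrightarrow> ((y - x) mod (2 * int n) = 0 \<and> odd ((b - a) mod 4)) \<or>
      (odd ((y - x) mod (2 * int n)) \<and> (b - a) mod 4 \<noteq> 2)"
    using n by (intro Sn_conn_iff) auto
  also have "(y - x) mod (2 * int n) = 0 \<longleftrightarrow> x = y"
  proof -
    have "(y - x) mod (2 * int n) = 0 \<longleftrightarrow> y mod (2 * int n) = x mod (2 * int n)"
      by (metis mod_eq_dvd_iff dvd_eq_mod_eq_0)
    then show ?thesis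
      using ranges by auto
  qed
  also have "odd ((y - x) mod (2 * int n)) \<longleftrightarrow> odd (y - x)"
    by (simp add: dvd_mod_iff)
  also have "odd ((b - a) mod 4) \<longleftrightarrow> odd (b - a)"
    by presburger
  finally show ?thesis .
qed

section \<open>Upper bounds for stable sets and cliques\<close>

lemma stability_number_eqI:
  assumes "finite (pverts G)" and "is_stable G T" "card T = k"
    and "\<And>U. is_stable G U \<Longrightarrow> card U \<le> k"
  shows "stability_number G = k"
proof -
  have "finite {U. is_stable G U}"
    by (rule finite_subset[of _ "Pow (pverts G)"]) (auto simp: is_stable_def assms(1))
  then show ?thesis
    unfolding stability_number_def using assms by (intro Max_eqI) auto
qed

lemma clique_number_eqI:
  assumes "finite (pverts G)" and "is_clique G C" "card C = k"
    and "\<And>D. is_clique G D \<Longrightarrow> card D \<le> k"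
  shows "clique_number G = k"
proof -
  have "finite {D. is_clique G D}"
    by (rule finite_subset[of _ "Pow (pverts G)"]) (auto simp: is_clique_def assms(1))
  then show ?thesis
    unfolding clique_number_def using assms by (intro Max_eqI) auto
qed

lemma card_stable_Sn_le:
  assumes n: "n \<ge> 2" and T: "is_stable (Sn n) T"
  shows "card T \<le> 2 * n"
proof -
  \<comment> \<open>The fibres of \<open>?f\<close> are the cliques of the partition, so
    \<open>?f\<close> should be injective on a stable set.\<close>
  let ?f = "\<lambda>(x, a). (x div 2, a div 2) :: int \<times> int"
  have sub: "T \<subseteq> {0..<2 * int n} \<times> {0..<4}"
    using T by (simp add: is_stable_def pverts_Sn[OF n])
  have "inj_on ?f T"
  proof (rule inj_onI, clarsimp, rule ccontr)
    fix x a y b :: int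
    assume uv: "(x, a) \<in> T" "(y, b) \<in> T" and eq: "x div 2 = y div 2" "a div 2 = b div 2"
      and ne: "\<not> (x = y \<and> a = b)"
    have "((x, a), (y, b)) \<notin> parcs (Sn n)"
      using uv ne T by (auto simp: is_stable_def)
    moreover have "(x, a) \<in> pverts (Sn n)" "(y, b) \<in> pverts (Sn n)"
      using uv T by (auto simp: is_stable_def)
    ultimately have "\<not> (x = y \<and> odd (b - a) \<or> odd (y - x) \<and> (b - a) mod 4 \<noteq> 2)"
      using arc_Sn_iff[OF n] by blast
    \<comment> \<open>Both coordinates differ by at most 1 and not both agree, which makes the two
      vertices adjacent.\<close>
    with eq ne show False
      by presburger
  qed
  moreover have "?f ` T \<subseteq> {0..<int n} \<times> {0..<2}"
    using sub by fastforce
  ultimately have "card T \<le> card ({0..<int n} \<times> {0..<2 :: int})"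
    by (intro card_inj_on_le) auto
  then show ?thesis
    by (simp add: card_cartesian_product)
qed

lemma card_clique_Sn_le:
  assumes n: "n \<ge> 2" and C: "is_clique (Sn n) C"
  shows "card C \<le> 4"
proof -
  \<comment> \<open>The fibres are the four parity classes: there both differences are even, which
    rules out an arc.\<close>
  let ?f = "\<lambda>(x, a). (x mod 2, a mod 2) :: int \<times> int"
  have "inj_on ?f C"
  proof (rule inj_onI, clarsimp, rule ccontr)
    fix x a y b :: int
    assume uv: "(x, a) \<in> C" "(y, b) \<in> C" and eq: "x mod 2 = y mod 2" "a mod 2 = b mod 2"
      and ne: "\<not> (x = y \<and> a = b)"
    have "((x, a), (y, b)) \<in> parcs (Sn n)"
      using uv ne C by (auto simp: is_clique_def)
    moreover have "(x, a) \<in> pverts (Sn n)" "(y, b) \<in> pverts (Sn n)"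
      using uv C by (auto simp: is_clique_def)
    ultimately have "x = y \<and> odd (b - a) \<or> odd (y - x) \<and> (b - a) mod 4 \<noteq> 2"
      using arc_Sn_iff[OF n] by blast
    with eq show False
      by presburger
  qed
  moreover have "?f ` C \<subseteq> {0..<2} \<times> {0..<2}"
    by auto
  ultimately have "card C \<le> card ({0..<2 :: int} \<times> {0..<2 :: int})"
    by (intro card_inj_on_le) auto
  then show ?thesis
    by (simp add: card_cartesian_product)
qed

section \<open>Squares contain all cliques\<close>

lemma is_clique_square_Sn:
  assumes n: "n \<ge> 2" and "x \<in> {0..<2 * int n}" "even x" "y \<in> {0..<2 * int n}" "odd y"
    and "c \<in> {0..<4}"
  shows "is_clique (Sn n) ({x, y} \<times> {c, (c + 1) mod 4})"
proof -
  have sub: "{x, y} \<times> {c, (c + 1) mod 4} \<subseteq> pverts (Sn n)"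
    using assms by (auto simp: pverts_Sn[OF n])
  have c: "c \<in> {0, 1, 2, 3}"
    using \<open>c \<in> {0..<4}\<close> by auto
  have "((p, a), (q, b)) \<in> parcs (Sn n)"
    if "(p, a) \<in> {x, y} \<times> {c, (c + 1) mod 4}" "(q, b) \<in> {x, y} \<times> {c, (c + 1) mod 4}"
      "(p, a) \<noteq> (q, b)" for p a q b
  proof -
    \<comment> \<open>Two levels from a cyclically consecutive pair differ by 0, 1 or 3 modulo
      4.\<close>
    have ab: "(b - a) mod 4 \<noteq> 2" "a \<noteq> b \<Longrightarrow> odd (b - a)"
      using that c by auto
    have "p = q \<or> odd (q - p)"
      using that assms(3,5) by auto
    then have "p = q \<and> odd (b - a) \<or> odd (q - p) \<and> (b - a) mod 4 \<noteq> 2"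
      using ab that(3) by auto
    moreover have "(p, a) \<in> pverts (Sn n)" "(q, b) \<in> pverts (Sn n)"
      using that sub by blast+
    ultimately show ?thesis
      by (simp add: arc_Sn_iff[OF n])
  qed
  then show ?thesis
    using sub unfolding is_clique_def by auto
qed

text \<open>Read \<open>a, b, c, d\<close> as a cycle: each opposite pair loses a member, and what
  remains is a pair of neighbours. It is applied to the second coordinates of a clique.\<close>

lemma subset_four_cycle:
  assumes Y: "Y \<subseteq> {a, b, c, d}" and "\<not> (a \<in> Y \<and> c \<in> Y)" "\<not> (b \<in> Y \<and> d \<in> Y)"
  shows "Y \<subseteq> {a, b} \<or> Y \<subseteq> {b, c} \<or> Y \<subseteq> {c, d} \<or> Y \<subseteq> {d, a}"
proof -
  have "Y \<subseteq> {a, b, c, d} - {p, q}" if "p \<notin> Y" "q \<notin> Y" for p q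
    using Y that by blast
  moreover have "a \<notin> Y \<or> c \<notin> Y" "b \<notin> Y \<or> d \<notin> Y"
    using assms by blast+
  ultimately have "Y \<subseteq> {a, b, c, d} - {a, b} \<or> Y \<subseteq> {a, b, c, d} - {a, d} \<or>
      Y \<subseteq> {a, b, c, d} - {c, b} \<or> Y \<subseteq> {a, b, c, d} - {c, d}"
    by meson
  moreover have "{a, b, c, d} - {a, b} \<subseteq> {c, d}" "{a, b, c, d} - {a, d} \<subseteq> {b, c}"
      "{a, b, c, d} - {c, b} \<subseteq> {d, a}" "{a, b, c, d} - {c, d} \<subseteq> {a, b}"
    by blast+
  ultimately show ?thesis
    by (meson subset_trans)
qed

text \<open>Adjacent vertices whose first coordinates have equal parity share the first coordinate,
  so a clique uses at most one even and one odd value; its levels are never antipodal.\<close>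

lemma clique_Sn_subset_square:
  assumes n: "n \<ge> 2" and C: "is_clique (Sn n) C"
  obtains x y c where "x \<in> {0..<2 * int n}" "even x" "y \<in> {0..<2 * int n}" "odd y"
    "c \<in> {0..<4}" "C \<subseteq> {x, y} \<times> {c, (c + 1) mod 4}"
proof -
  have sub: "C \<subseteq> {0..<2 * int n} \<times> {0..<4}"
    using C by (simp add: is_clique_def pverts_Sn[OF n])
  have arc: "(p = q \<and> odd (b - a)) \<or> (odd (q - p) \<and> (b - a) mod 4 \<noteq> 2)"
    if "(p, a) \<in> C" "(q, b) \<in> C" "(p, a) \<noteq> (q, b)" for p a q b
    using arc_Sn_iff[OF n, of p a q b] that C by (auto simp: is_clique_def subset_iff)
  have same: "p = q" if "(p, a) \<in> C" "(q, b) \<in> C" "even p = even q" for p a q b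
    using arc[OF that(1,2)] that(3) by auto
  have fibre: "\<exists>x. x \<in> {0..<2 * int n} \<and> even x = e \<and> (\<forall>(p, a) \<in> C. even p = e \<longrightarrow> p = x)" for e
  proof (cases "\<exists>p a. (p, a) \<in> C \<and> even p = e")
    case True
    then show ?thesis
      using same sub by fast
  next
    \<comment> \<open>A parity absent from \<open>C\<close> gets the default coordinate 0 or 1, so
      that a full square exists even for a clique inside one Z_4.\<close>
    case False
    then show ?thesis
      using n by (intro exI[of _ "if e then 0 else 1"]) auto
  qed
  obtain x where x: "x \<in> {0..<2 * int n}" "even x" "\<forall>(p, a) \<in> C. even p \<longrightarrow> p = x"
    using fibre[of True] by auto
  obtain y where y: "y \<in> {0..<2 * int n}" "odd y" "\<forall>(p, a) \<in> C. odd p \<longrightarrow> p = y"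
    using fibre[of False] by auto
  have no2: "(b - a) mod 4 \<noteq> 2" if ab: "a \<in> snd ` C" "b \<in> snd ` C" for a b
  proof -
    obtain p q where "(p, a) \<in> C" "(q, b) \<in> C"
      using ab by auto
    \<comment> \<open>The case \<open>a = b\<close> covers two choices of the same vertex.\<close>
    then have "a = b \<or> odd (b - a) \<or> (b - a) mod 4 \<noteq> 2"
      using arc by blast
    then show ?thesis
      by presburger
  qed
  have snd4: "snd ` C \<subseteq> {0, 1, 2, 3}"
    using sub by auto
  have "\<not> (0 \<in> snd ` C \<and> 2 \<in> snd ` C)" "\<not> (1 \<in> snd ` C \<and> 3 \<in> snd ` C)"
    using no2[of 0 2] no2[of 1 3] by auto
  with snd4 have "snd ` C \<subseteq> {0, 1} \<or> snd ` C \<subseteq> {1, 2} \<or> snd ` C \<subseteq> {2, 3} \<or> snd ` C \<subseteq> {3, 0}"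
    by (rule subset_four_cycle)
  then have "\<exists>c\<in>{0, 1, 2, 3}. snd ` C \<subseteq> {c, (c + 1) mod 4}"
    by simp
  moreover have "{0, 1, 2, 3} \<subseteq> {0..<4 :: int}"
    by simp
  ultimately obtain c where c: "c \<in> {0..<4}" "snd ` C \<subseteq> {c, (c + 1) mod 4}"
    by blast
  have fst: "fst ` C \<subseteq> {x, y}"
    using x(3) y(3) by fastforce
  have "C \<subseteq> {x, y} \<times> {c, (c + 1) mod 4}"
    by (rule subset_trans[OF subset_fst_snd Sigma_mono[OF fst c(2)]])
  with x(1,2) y(1,2) c(1) show thesis
    by (rule that)
qed

section \<open>The CIS property\<close>

text \<open>Otherwise \<open>insert v T\<close> would be a larger stable set. Both arc directions
  appear because \<open>is_stable\<close> ranges over ordered pairs.\<close>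

lemma maximal_stableD:
  assumes "maximal_stable G T" "v \<in> pverts G"
    and "\<And>u. u \<in> T \<Longrightarrow> u \<noteq> v \<Longrightarrow> (u, v) \<notin> parcs G \<and> (v, u) \<notin> parcs G"
  shows "v \<in> T"
proof -
  have "is_stable G (insert v T)"
    using assms unfolding maximal_stable_def is_stable_def by auto
  then show ?thesis
    using assms(1) unfolding maximal_stable_def by blast
qed

lemma CIS_Sn:
  assumes n: "n \<ge> 2"
  shows "CIS (Sn n)"
  unfolding CIS_def
proof (intro allI impI, elim conjE)
  fix T C assume T: "maximal_stable (Sn n) T" and C: "maximal_clique (Sn n) C"
  have "is_clique (Sn n) C"
    using C by (simp add: maximal_clique_def)
  then obtain x y c where sq: "x \<in> {0..<2 * int n}" "even x" "y \<in> {0..<2 * int n}" "odd y"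
      "c \<in> {0..<4}" and Csub: "C \<subseteq> {x, y} \<times> {c, (c + 1) mod 4}"
    using clique_Sn_subset_square[OF n] by metis
  \<comment> \<open>The square is itself a clique, so maximality of \<open>C\<close> gives
    equality.\<close>
  then have Ceq: "C = {x, y} \<times> {c, (c + 1) mod 4}"
    using C is_clique_square_Sn[OF n sq] unfolding maximal_clique_def by blast
  have sub: "T \<subseteq> pverts (Sn n)"
    using T by (simp add: maximal_stable_def is_stable_def)
  have nonadj: "\<not> (x = y \<and> odd (b - a) \<or> odd (y - x) \<and> (b - a) mod 4 \<noteq> 2)"
    if "(x, a) \<in> T" "(y, b) \<in> T" for x a y b
  proof (cases "(x, a) = (y, b)")
    case False
    then have "((x, a), (y, b)) \<notin> parcs (Sn n)"
      using that T by (simp add: maximal_stable_def is_stable_def)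
    moreover have "(x, a) \<in> pverts (Sn n)" "(y, b) \<in> pverts (Sn n)"
      using that sub by blast+
    ultimately show ?thesis
      using arc_Sn_iff[OF n] by blast
  qed simp
  have memI: "(x, a) \<in> T" if "x \<in> {0..<2 * int n}" "a \<in> {0..<4}"
    and "\<And>y b. (y, b) \<in> T \<Longrightarrow> \<not> (x = y \<and> odd (b - a) \<or> odd (y - x) \<and> (b - a) mod 4 \<noteq> 2)"
    for x a
  proof (rule maximal_stableD[OF T])
    show mem: "(x, a) \<in> pverts (Sn n)"
      using that by (auto simp: pverts_Sn[OF n])
    fix u assume u: "u \<in> T"
    obtain y b where yb: "u = (y, b)"
      by (cases u)
    have no: "\<not> (x = y \<and> odd (b - a) \<or> odd (y - x) \<and> (b - a) mod 4 \<noteq> 2)"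
      using that(3) u yb by blast
    \<comment> \<open>Negating a difference preserves its parity and whether it is 2 modulo
      4.\<close>
    then have no': "\<not> (y = x \<and> odd (a - b) \<or> odd (x - y) \<and> (a - b) mod 4 \<noteq> 2)"
      by presburger
    have "(y, b) \<in> pverts (Sn n)"
      using sub u yb by blast
    then show "(u, (x, a)) \<notin> parcs (Sn n) \<and> ((x, a), u) \<notin> parcs (Sn n)"
      using no no' arc_Sn_iff[OF n _ mem] arc_Sn_iff[OF n mem] unfolding yb by blast
  qed
  show "T \<inter> C \<noteq> {}"
  proof (cases "(\<exists>p a. (p, a) \<in> T \<and> even p) \<and> (\<exists>q b. (q, b) \<in> T \<and> odd q)")
    case True
    then obtain p a q b where pa: "(p, a) \<in> T" "even p" and qb: "(q, b) \<in> T" "odd q"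
      by blast
    \<comment> \<open>Opposite parities without an arc force antipodal levels. Hence every even
      vertex of \<open>T\<close> has level \<open>a\<close> and every odd one level
      \<open>b\<close>.\<close>
    have ab: "a \<in> {0..<4}" "b \<in> {0..<4}" "(b - a) mod 4 = 2"
      using pa qb sub nonadj[OF pa(1) qb(1)] by (auto simp: pverts_Sn[OF n])
    have ev: "d = a" if "(r, d) \<in> T" "even r" for r d
    proof -
      have "d \<in> {0..<4}" "(b - d) mod 4 = 2"
        using that qb sub nonadj[OF that(1) qb(1)] by (auto simp: pverts_Sn[OF n])
      with ab show ?thesis by auto presburger
    qed
    have od: "d = b" if "(r, d) \<in> T" "odd r" for r d
    proof -
      have "d \<in> {0..<4}" "(d - a) mod 4 = 2"
        using that pa sub nonadj[OF pa(1) that(1)] by (auto simp: pverts_Sn[OF n])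
      with ab show ?thesis by auto presburger
    qed
    \<comment> \<open>Even vertices of \<open>T\<close> share the level \<open>a\<close> and odd
      ones are antipodal to it, so none is adjacent to \<open>(x, a)\<close>.\<close>
    have x: "(x, a) \<in> T"
    proof (rule memI)
      fix r d assume "(r, d) \<in> T"
      then show "\<not> (x = r \<and> odd (d - a) \<or> odd (r - x) \<and> (d - a) mod 4 \<noteq> 2)"
        using ev[of r d] od[of r d] ab(3) sq(2) by auto
    qed (use sq ab in auto)
    have y: "(y, b) \<in> T"
    proof (rule memI)
      fix r d assume "(r, d) \<in> T"
      moreover have "(a - b) mod 4 = 2"
        using ab(3) by presburger
      ultimately show "\<not> (y = r \<and> odd (d - b) \<or> odd (r - y) \<and> (d - b) mod 4 \<noteq> 2)"
        using ev[of r d] od[of r d] sq(4) by auto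
    qed (use sq ab in auto)
    \<comment> \<open>A cyclically consecutive pair meets every antipodal pair.\<close>
    have "a \<in> {c, (c + 1) mod 4} \<or> b \<in> {c, (c + 1) mod 4}"
    proof -
      have "a \<in> {0, 1, 2, 3}" "b \<in> {0, 1, 2, 3}" "c \<in> {0, 1, 2, 3}"
        using ab sq(5) by auto
      then show ?thesis
        using ab(3) by auto
    qed
    then show ?thesis
      using x y unfolding Ceq by blast
  next
    case False
    \<comment> \<open>Here \<open>z\<close> is the first coordinate of the clique whose parity is
      the one occurring in \<open>T\<close>.\<close>
    then have "\<exists>z\<in>{x, y}. \<forall>(q, b) \<in> T. even q = even z"
      using sq(2,4) by auto
    then obtain z where z: "z \<in> {x, y}" and par: "\<And>q b. (q, b) \<in> T \<Longrightarrow> even q = even z"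
      by blast
    have zr: "z \<in> {0..<2 * int n}"
      using z sq by auto
    \<comment> \<open>Different columns of equal parity are not joined, so a vertex missing from
      \<open>T\<close> is blocked within its own column.\<close>
    have nb: "\<exists>b. (z, b) \<in> T \<and> odd (b - a)" if a: "a \<in> {0..<4}" "(z, a) \<notin> T" for a
    proof -
      obtain q b where "(q, b) \<in> T"
          and "z = q \<and> odd (b - a) \<or> odd (q - z) \<and> (b - a) mod 4 \<noteq> 2"
        using memI[OF zr a(1)] a(2) by blast
      then show ?thesis
        using par[of q b] by auto
    qed
    show ?thesis
    proof
      assume "T \<inter> C = {}"
      then have "(z, c) \<notin> T" "(z, (c + 1) mod 4) \<notin> T"
        using z unfolding Ceq by blast+
      \<comment> \<open>The blockers of the two consecutive levels have levels of opposite parity in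
        the same column, so they are adjacent to each other.\<close>
      then obtain b d where "(z, b) \<in> T" "odd (b - c)" "(z, d) \<in> T" "odd (d - (c + 1) mod 4)"
        using nb[of c] nb[of "(c + 1) mod 4"] sq(5) by auto
      moreover from this have "odd (d - b)"
        by presburger
      ultimately show False
        using nonadj[of z b z d] by blast
    qed
  qed
qed

section \<open>Exact stability and clique numbers\<close>

lemma stability_number_Sn:
  assumes n: "n \<ge> 2"
  shows "stability_number (Sn n) = 2 * n"
proof (rule stability_number_eqI)
  \<comment> \<open>The class with both coordinates even attains the bound.\<close>
  let ?E = "(\<lambda>i. 2 * i) ` {0..<int n}"
  have sub: "?E \<times> {0, 2} \<subseteq> pverts (Sn n)"
    by (auto simp: pverts_Sn[OF n])
  have "((p, a), (q, b)) \<notin> parcs (Sn n)"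
    if "(p, a) \<in> ?E \<times> {0, 2}" "(q, b) \<in> ?E \<times> {0, 2}" for p a q b
  proof -
    have "\<not> (p = q \<and> odd (b - a) \<or> odd (q - p) \<and> (b - a) mod 4 \<noteq> 2)"
      using that by auto
    moreover have "(p, a) \<in> pverts (Sn n)" "(q, b) \<in> pverts (Sn n)"
      using that sub by blast+
    ultimately show ?thesis
      by (simp add: arc_Sn_iff[OF n])
  qed
  then show "is_stable (Sn n) (?E \<times> {0, 2})"
    using sub unfolding is_stable_def by auto
  have "card ?E = n"
    by (subst card_image) (auto simp: inj_on_def)
  then show "card (?E \<times> {0, 2 :: int}) = 2 * n"
    by (simp add: card_cartesian_product)
qed (use n card_stable_Sn_le in \<open>auto simp: pverts_Sn\<close>)

lemma clique_number_Sn: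
  assumes n: "n \<ge> 2"
  shows "clique_number (Sn n) = 4"
proof (rule clique_number_eqI)
  show "is_clique (Sn n) ({0, 1} \<times> {0, (0 + 1) mod 4})"
    using n by (intro is_clique_square_Sn) auto
qed (use n card_clique_Sn_le in \<open>auto simp: pverts_Sn card_cartesian_product\<close>)

section \<open>Connectedness\<close>

text \<open>Any two vertices are joined by a walk of length one or two.\<close>

lemma connected_Sn:
  assumes n: "n \<ge> 2"
  shows "Digraph_Component.connected (with_proj (Sn n))"
proof -
  interpret pair_graph "Sn n"
    by (rule pair_graph_Sn[OF n])
  have arc: "(u, v) \<in> parcs (Sn n)"
    if "u \<in> pverts (Sn n)" "v \<in> pverts (Sn n)"
      "(fst u = fst v \<and> odd (snd v - snd u)) \<or>
       (odd (fst v - fst u) \<and> (snd v - snd u) mod 4 \<noteq> 2)" for u v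
    using arc_Sn_iff[OF n, of "fst u" "snd u" "fst v" "snd v"] that by simp
  have reach: "u \<rightarrow>\<^sup>*\<^bsub>with_proj (Sn n)\<^esub> v" if u: "u \<in> pverts (Sn n)" and v: "v \<in> pverts (Sn n)" for u v
  proof -
    obtain x a y b where uv: "u = (x, a)" "v = (y, b)"
      by (cases u, cases v)
    have ranges: "0 \<le> x" "x < 2 * int n" "0 \<le> y" "y < 2 * int n"
      "a \<in> {0, 1, 2, 3}" "b \<in> {0, 1, 2, 3}"
      using u v by (auto simp: uv pverts_Sn[OF n])
    have via: "u \<rightarrow>\<^sup>*\<^bsub>with_proj (Sn n)\<^esub> v"
      if "w \<in> pverts (Sn n)" "(u, w) \<in> parcs (Sn n)" "(w, v) \<in> parcs (Sn n)" for w
      using that by (metis adj_reachable_trans reachable_adjI)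
    consider "odd (y - x)" "(b - a) mod 4 \<noteq> 2" | "odd (y - x)" "(b - a) mod 4 = 2" | "even (y - x)"
      by blast
    then show ?thesis
    proof cases
      case 1
      then have "(u, v) \<in> parcs (Sn n)"
        using u v by (intro arc) (auto simp: uv)
      then show ?thesis
        by (rule reachable_adjI)
    next
      case 2
      \<comment> \<open>One step up in the column of \<open>u\<close> turns the level difference
        from 2 into 1.\<close>
      let ?w = "(x, (a + 1) mod 4)"
      have w: "?w \<in> pverts (Sn n)"
        using ranges by (auto simp: pverts_Sn[OF n])
      have "odd ((a + 1) mod 4 - a)" "(b - (a + 1) mod 4) mod 4 \<noteq> 2"
        using 2 by presburger+
      then show ?thesis
        using 2 w u v by (intro via[of ?w] arc) (auto simp: uv)
    next
      case 3
      obtain z :: int where z: "z \<in> {0, 1}" "odd (z - x)"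
        by (cases "even x") (use that[of 1] that[of 0] in auto)
      \<comment> \<open>Only the antipodes of \<open>a\<close> and \<open>b\<close> are forbidden,
        so at least two levels remain.\<close>
      obtain c :: int where c: "c \<in> {0, 1, 2, 3}" "(c - a) mod 4 \<noteq> 2" "(b - c) mod 4 \<noteq> 2"
        using ranges(5,6) by fastforce
      have w: "(z, c) \<in> pverts (Sn n)"
        using z(1) c(1) n by (auto simp: pverts_Sn[OF n])
      have "odd (y - z)"
        using 3 z(2) by presburger
      then show ?thesis
        using z c w u v by (intro via[of "(z, c)"] arc) (auto simp: uv)
    qed
  qed
  have "pverts (Sn n) \<noteq> {}"
    using n by (auto simp: pverts_Sn)
  \<comment> \<open>\<open>connected\<close> means that the symmetric closure is strongly connected,
    which includes a nonempty vertex set.\<close>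
  then show ?thesis
    using reach reachable_mk_symmetricI
    by (auto simp: Digraph_Component.connected_def strongly_connected_def)
qed

theorem proposition3p7:
  fixes n :: nat
  assumes "n \<ge> 2"
  shows "Digraph_Component.connected (with_proj (Sn n)) \<and> CIS (Sn n) \<and>
    card (pverts (Sn n)) = 8 * n \<and> has_valency (Sn n) (3 * n + 2) \<and>
    stability_number (Sn n) = 2 * n \<and> clique_number (Sn n) = 4"
proof (intro conjI)
  show "card (pverts (Sn n)) = 8 * n"
    by (simp add: pverts_Sn[OF assms] card_cartesian_product)
  have "Sn_conn n \<subseteq> carrier (Sn_group n)"
    using assms by (auto simp: Sn_conn_def carrier_integer_mod_group)
  then show "has_valency (Sn n) (3 * n + 2)"
    using has_valency_cayley_graph[of "Sn_group n" "Sn_conn n"]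
    by (simp add: Sn_def card_Sn_conn DirProd_group)
qed (use assms connected_Sn CIS_Sn stability_number_Sn clique_number_Sn in auto)

end
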